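(* There exists a sequence of positive real numbers $(A_k)_{k \geq 1}$ such that, for every real $a > 1$ and every arithmetic function $\phi$ satisfying $|\phi(k)| < a^k$ for all positive integers $k$, the series $$M_\phi := \sum_{k=1}^\infty A_k \phi(k)$$ converges and $$\sum_{n \leq x} \phi(f(n)) = M_\phi x + O_{a,\varepsilon}\left(x^{1/2+\varepsilon}\right)$$ for all real $x \geq 1$ and $\varepsilon > 0$, where $n$ runs over positive integers and the convention $\phi(0) := 0$ is used for the term $n = 1$. The implied constant depends only on $a$ and $\varepsilon$.
   Context: For a natural number $n > 1$ with prime factorization $n = p_1^{a_1}\cdots p_s^{a_s}$ ($p_1 < \cdots < p_s$ primes, $a_1,\dots,a_s$ positive integers), $f(n) := \#\{a_1,\dots,a_s\}$ is the number of distinct exponents; also $f(1) := 0$. An arithmetic function is a complex-valued function on the positive integers. $O_{a,\varepsilon}$ means the implied constant may depend on $a$ and $\varepsilon$. *)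

theory Defs
  imports "HOL-Analysis.Analysis" "HOL-Computational_Algebra.Primes"
begin

(* The image is a set, so repeated exponents are counted once; prime_factors 1 = {} gives f(1) = 0. *)
definition num_distinct_exponents :: "nat \<Rightarrow> nat" where
  "num_distinct_exponents n = card ((\<lambda>p. multiplicity p n) ` prime_factors n)"

(* An arithmetic function lives on the positive integers; it is represented by its extension
   to nat with value 0 at 0, as the term n = 1 of the summatory function requires.
   The growth bound concerns positive arguments only. *)
definition arithmetic_fun_bounded :: "real \<Rightarrow> (nat \<Rightarrow> complex) \<Rightarrow> bool" where
  "arithmetic_fun_bounded a \<phi> \<longleftrightarrow> \<phi> 0 = 0 \<and> (\<forall>k\<ge>1. norm (\<phi> k) < a ^ k)"

(* The series over k >= 1 is shifted to start at index 0. *)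
definition M_term :: "(nat \<Rightarrow> real) \<Rightarrow> (nat \<Rightarrow> complex) \<Rightarrow> nat \<Rightarrow> complex" where
  "M_term A \<phi> k = of_real (A (Suc k)) * \<phi> (Suc k)"

definition M_const :: "(nat \<Rightarrow> real) \<Rightarrow> (nat \<Rightarrow> complex) \<Rightarrow> complex" where
  "M_const A \<phi> = (\<Sum>k. M_term A \<phi> k)"

end

theory Submission
  imports Defs "HOL-Computational_Algebra.Squarefree" "HOL-Real_Asymp.Real_Asymp"
begin

text \<open>
  Let \<open>f\<close> count the distinct exponents, and let \<open>f1(n)\<close> count the distinct exponents of \<open>n\<close>
  together with the exponent 1, present or not. Multiplying \<open>n\<close> by a new prime does not change
  \<open>f1(n)\<close>. Hence the Moebius transform \<open>g = \<mu> * F\<close> of \<open>F(n) = \<phi>(f1(n))\<close> vanishes at every \<open>n\<close> with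
  a prime divisor of exponent 1: it lives on the powerful numbers
  (\<open>moebius_transform_eq_0\<close>). These are so sparse that the sum of \<open>n powr - t\<close> over them
  converges for every \<open>t > 1/2\<close>. Moreover \<open>\<bar>g(n)\<bar> \<le> a * (2 * a) ^ \<omega>(n)\<close>, where \<open>\<omega>(n)\<close> is the number
  of prime divisors of \<open>n\<close>, and this grows more slowly than any positive power of \<open>n\<close>; so the sum of
  \<open>\<bar>g(n)\<bar> * n powr - t\<close> converges too, with a bound depending only on \<open>a\<close> and \<open>t\<close>.

  By Moebius inversion, the sum of \<open>F(n)\<close> over \<open>n \<le> x\<close> is the sum of \<open>g(d) * \<lfloor>x / d\<rfloor>\<close> over all \<open>d\<close>.
  Since \<open>\<lfloor>y\<rfloor>\<close> and \<open>y\<close> differ by at most \<open>y powr t\<close> for \<open>0 \<le> t \<le> 1\<close>, this is \<open>M * x + O(x powr t)\<close> with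
  \<open>M\<close> the sum of \<open>g(d) / d\<close> (\<open>sum_divisor_sums_asymptotic\<close>). Finally, \<open>f\<close> and \<open>f1\<close> differ only
  at powerful numbers, of which there are too few to matter
  (\<open>sum_num_distinct_exponents_asymptotic\<close>).

  The coefficient \<open>A\<^sub>k\<close> is the density of the set where \<open>f1 = k\<close>, that is \<open>M\<close> for the indicator
  function of \<open>k\<close>. That \<open>M\<close> is the sum of \<open>A\<^sub>k * \<phi>(k)\<close> is an exchange of limits, justified by dominated
  convergence (\<open>level_density_sums\<close>). For \<open>A\<^sub>k > 0\<close>, take one \<open>s\<close> with \<open>f1(s) = k\<close> and multiply it
  by squarefree numbers congruent to 1 modulo \<open>s\<close>, which have positive lower density
  (\<open>level_density_pos\<close>).
\<close>

section \<open>The Moebius transform\<close>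

text \<open>
  This is the Dirichlet convolution \<open>\<mu> * F\<close>, with \<open>\<mu>\<close> expanded over the squarefree
  divisors of \<open>n\<close>, each encoded as the set of its primes. Both cancellations needed below
  are then cancellations between finite sets of opposite parity.
\<close>

definition moebius_transform :: "(nat \<Rightarrow> 'a) \<Rightarrow> nat \<Rightarrow> 'a :: comm_ring_1" where
  "moebius_transform F n =
     (\<Sum>S\<in>Pow (prime_factors n). (-1) ^ card S * F (n div \<Prod>S))"

definition powerful :: "nat \<Rightarrow> bool" where
  "powerful n \<longleftrightarrow> n > 0 \<and> (\<forall>p. prime p \<longrightarrow> p dvd n \<longrightarrow> p\<^sup>2 dvd n)"

lemma prod_primes_dvd_iff:
  fixes S :: "nat set"
  assumes "finite S" "\<And>p. p \<in> S \<Longrightarrow> prime p"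
  shows "\<Prod>S dvd n \<longleftrightarrow> (\<forall>p\<in>S. p dvd n)"
  using assms
proof (induction S rule: finite_induct)
  case (insert p S)
  have "coprime p (\<Prod>S)"
    using insert by (intro prod_coprime_right) (metis primes_coprime insertCI)
  then show ?case
    using insert by (auto intro: divides_mult dest: dvd_mult_left dvd_mult_right)
qed auto

lemma sum_Pow_alternating:
  assumes "finite P"
  shows "(\<Sum>S\<in>Pow P. (-1) ^ card S) = (if P = {} then 1 else 0 :: 'a :: comm_ring_1)"
proof -
  have "(\<Prod>x\<in>P. (-1) + (1::'a)) = (\<Sum>S\<in>Pow P. (\<Prod>x\<in>S. -1) * (\<Prod>x\<in>P-S. 1))"
    using assms by (rule prod_add)
  also have "\<dots> = (\<Sum>S\<in>Pow P. (-1) ^ card S)"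
    by simp
  finally show ?thesis
    using assms by (auto simp: power_0_left card_eq_0_iff split: if_splits)
qed

lemma finite_prime_factor_subset:
  "S \<subseteq> prime_factors n \<Longrightarrow> finite S"
  by (rule finite_subset) auto

lemma prod_prime_factors_subset_dvd:
  fixes n :: nat
  assumes "S \<subseteq> prime_factors n"
  shows "\<Prod>S dvd n"
  using assms finite_prime_factor_subset[OF assms]
  by (subst prod_primes_dvd_iff) auto

lemma prod_primes_pos:
  fixes n :: nat
  assumes "S \<subseteq> prime_factors n"
  shows "\<Prod>S > 0"
  using assms by (intro prod_pos) (auto simp: prime_gt_0_nat subset_iff in_prime_factors_iff)

text \<open>
  Substituting \<open>d = m * \<Prod>S\<close> turns the double sum over \<open>(d, S)\<close> into a sum over the divisors
  \<open>m\<close> of \<open>n\<close> of \<open>F m\<close>, weighted by the alternating sum over all sets of primes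
  dividing \<open>n div m\<close>. That alternating sum vanishes unless \<open>n div m = 1\<close>.
\<close>

lemma moebius_inversion:
  fixes F :: "nat \<Rightarrow> 'a :: comm_ring_1"
  assumes n: "n > 0"
  shows "(\<Sum>d | d dvd n. moebius_transform F d) = F n"
proof -
  have fin: "finite {d. d dvd n}" using n by simp
  have "(\<Sum>d | d dvd n. moebius_transform F d) =
        (\<Sum>(d, S) \<in> (SIGMA d:{d. d dvd n}. Pow (prime_factors d)). (-1) ^ card S * F (d div \<Prod>S))"
    unfolding moebius_transform_def using fin by (subst sum.Sigma) auto
  also have "\<dots> = (\<Sum>(m, S) \<in> (SIGMA m:{m. m dvd n}. Pow (prime_factors (n div m))). (-1) ^ card S * F m)"
  proof (rule sum.reindex_bij_witness[where i = "\<lambda>(m, S). (m * \<Prod>S, S)"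
                                        and j = "\<lambda>(d, S). (d div \<Prod>S, S)"], goal_cases)
    case (1 a)
    then show ?case using prod_prime_factors_subset_dvd by (auto split: prod.splits)
  next
    case (2 a)
    obtain d S where a: "a = (d, S)" "d dvd n" "S \<subseteq> prime_factors d"
      using 2 by auto
    have *: "\<Prod>S dvd d" by (rule prod_prime_factors_subset_dvd) fact
    then obtain m where m: "d = \<Prod>S * m" by auto
    obtain e where e: "n = d * e" using a by auto
    have pos: "\<Prod>S > 0" by (rule prod_primes_pos) fact
    have "n div m = \<Prod>S * e" using n e m pos by auto
    moreover have "S \<subseteq> prime_factors (\<Prod>S * e)"
      using n e m a finite_prime_factor_subset[OF a(3)]
      by (auto simp: in_prime_factors_iff subset_iff intro!: dvd_mult2 dvd_prodI)
    ultimately show ?case using a m pos e by auto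
  next
    case (3 b)
    obtain m S where b: "b = (m, S)" "m dvd n" "S \<subseteq> prime_factors (n div m)"
      using 3 by auto
    then show ?case using prod_primes_pos[OF b(3)] by auto
  next
    case (4 b)
    obtain m S where b: "b = (m, S)" "m dvd n" "S \<subseteq> prime_factors (n div m)"
      using 4 by auto
    have pos: "\<Prod>S > 0" by (rule prod_primes_pos) fact
    have "m * \<Prod>S dvd m * (n div m)"
      using prod_prime_factors_subset_dvd[OF b(3)] by (intro mult_dvd_mono) auto
    then have "m * \<Prod>S dvd n" using b(2) by simp
    moreover have "S \<subseteq> prime_factors (m * \<Prod>S)"
      using n b pos finite_prime_factor_subset[OF b(3)]
      by (auto simp: in_prime_factors_iff subset_iff intro!: dvd_mult dvd_prodI)
    ultimately show ?case using b by auto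
  next
    case (5 a)
    then show ?case by auto
  qed
  also have "\<dots> = (\<Sum>m | m dvd n. F m * (\<Sum>S\<in>Pow (prime_factors (n div m)). (-1) ^ card S))"
    using fin by (subst sum.Sigma[symmetric]) (auto simp: sum_distrib_left mult.commute)
  also have "\<dots> = (\<Sum>m | m dvd n. if m = n then F m else 0)"
  proof (intro sum.cong refl)
    fix m assume "m \<in> {m. m dvd n}"
    then have "prime_factors (n div m) = {} \<longleftrightarrow> m = n"
      using n by (auto simp: prime_factorization_empty_iff elim!: dvdE)
    then show "F m * (\<Sum>S\<in>Pow (prime_factors (n div m)). (-1) ^ card S) = (if m = n then F m else 0)"
      by (simp add: sum_Pow_alternating)
  qed
  also have "\<dots> = F n"
    using fin by simp
  finally show ?thesis .
qed

text \<open>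
  If \<open>p\<close> divides \<open>n\<close> exactly once, then the terms of \<open>S\<close> and \<open>insert p S\<close> cancel: their
  arguments differ by the factor \<open>p\<close>, which occurs exactly once and so does not change \<open>F\<close>.
\<close>

lemma moebius_transform_eq_0:
  fixes F :: "nat \<Rightarrow> 'a :: comm_ring_1"
  assumes F: "\<And>p n. prime p \<Longrightarrow> n > 0 \<Longrightarrow> \<not> p dvd n \<Longrightarrow> F (p * n) = F n"
  assumes n: "\<not> powerful n" "n > 0"
  shows "moebius_transform F n = 0"
proof -
  obtain p where p: "prime p" "p dvd n" "\<not> p\<^sup>2 dvd n"
    using n by (auto simp: powerful_def)
  define P where "P = prime_factors n - {p}"
  have P: "prime_factors n = insert p P" "p \<notin> P" "finite P"
    using p n by (auto simp: P_def in_prime_factors_iff)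
  have inj: "inj_on (insert p) (Pow P)"
    using P by (auto simp: inj_on_def)
  have "moebius_transform F n =
      (\<Sum>S\<in>Pow P. (-1) ^ card S * F (n div \<Prod>S)) +
      (\<Sum>S\<in>Pow P. (-1) ^ card (insert p S) * F (n div \<Prod>(insert p S)))"
    unfolding moebius_transform_def P(1) Pow_insert using P inj
    by (subst sum.union_disjoint) (auto simp: sum.reindex)
  also have "(\<Sum>S\<in>Pow P. (-1) ^ card (insert p S) * F (n div \<Prod>(insert p S))) =
             (\<Sum>S\<in>Pow P. - ((-1) ^ card S * F (n div \<Prod>S)))"
  proof (intro sum.cong refl)
    fix S assume S: "S \<in> Pow P"
    have fin: "finite S" "p \<notin> S" using S P by (auto intro: finite_subset)
    have sub: "insert p S \<subseteq> prime_factors n" using S P by auto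
    have pos: "\<Prod>S > 0" using sub prod_primes_pos[of S n] by auto
    have "p * \<Prod>S dvd n"
      using prod_prime_factors_subset_dvd[OF sub] fin by simp
    then obtain m where m: "n = p * \<Prod>S * m" by auto
    have "m > 0" "\<not> p dvd m" using m p n by (auto simp: power2_eq_square)
    then have "F (p * m) = F m" using p F by blast
    moreover have "n div \<Prod>S = p * m" using m pos by simp
    moreover have "n div \<Prod>(insert p S) = m" using m pos fin prime_gt_0_nat[OF p(1)] by simp
    ultimately show "(-1) ^ card (insert p S) * F (n div \<Prod>(insert p S)) =
         - ((-1) ^ card S * F (n div \<Prod>S))"
      using fin by simp
  qed
  also have "(\<Sum>S\<in>Pow P. (-1) ^ card S * F (n div \<Prod>S)) + \<dots> = 0"
    by (simp add: sum_negf)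
  finally show ?thesis .
qed

lemma norm_moebius_transform_le:
  fixes F :: "nat \<Rightarrow> 'a :: {comm_ring_1, real_normed_algebra_1}"
  assumes "\<And>m. m dvd n \<Longrightarrow> norm (F m) \<le> B"
  shows "norm (moebius_transform F n) \<le> 2 ^ card (prime_factors n) * B"
proof -
  have "norm (moebius_transform F n) \<le> (\<Sum>S\<in>Pow (prime_factors n). B)"
    unfolding moebius_transform_def
  proof (rule sum_norm_le)
    fix S assume "S \<in> Pow (prime_factors n)"
    then have "n div \<Prod>S dvd n"
      using prod_prime_factors_subset_dvd[of S n] by (auto elim!: dvdE)
    moreover have "norm ((-1) ^ card S * F (n div \<Prod>S)) = norm (F (n div \<Prod>S))"
      by (cases "even (card S)") auto
    ultimately show "norm ((-1) ^ card S * F (n div \<Prod>S)) \<le> B"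
      using assms by simp
  qed
  also have "\<dots> = 2 ^ card (prime_factors n) * B"
    by (simp add: card_Pow)
  finally show ?thesis .
qed

section \<open>Sums over powerful numbers\<close>

text \<open>
  Write \<open>n = v * q\<^sup>2\<close> with \<open>v\<close> squarefree. A prime divisor of \<open>v\<close> has odd exponent in \<open>n\<close>,
  hence exponent at least 3, and therefore divides \<open>q\<close>; so \<open>v\<close> divides \<open>q\<close>, and \<open>u = q div v\<close>.
\<close>

lemma powerful_decompose:
  assumes "powerful n"
  obtains u v where "n = u\<^sup>2 * v ^ 3"
proof -
  define v where "v = squarefree_part n"
  define q where "q = square_part n"
  have n: "n = v * q\<^sup>2" unfolding v_def q_def by (rule squarefree_decompose)
  have n0: "n > 0" using assms by (simp add: powerful_def)
  have q0: "q \<noteq> 0" and v0: "v \<noteq> 0" using n n0 by (auto intro!: Nat.gr0I)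
  have "v dvd q"
  proof (rule multiplicity_le_imp_dvd)
    fix p :: nat assume p: "prime p"
    show "multiplicity p v \<le> multiplicity p q"
    proof (cases "p dvd v")
      case True
      have 1: "multiplicity p v \<le> 1"
        using p by (auto simp: v_def prime_multiplicity_squarefree_part)
      have "p\<^sup>2 dvd n" using assms p True n by (auto simp: powerful_def)
      then have "2 \<le> multiplicity p n"
        using n0 p by (subst (asm) power_dvd_iff_le_multiplicity) auto
      also have "multiplicity p n = multiplicity p v + 2 * multiplicity p q"
        unfolding n using p v0 q0
        by (simp add: prime_elem_multiplicity_mult_distrib prime_elem_multiplicity_power_distrib)
      finally show ?thesis using 1 by linarith
    qed (simp add: not_dvd_imp_multiplicity_0)
  qed (use v0 in auto)
  then obtain u where "q = v * u" by auto
  then have "n = u\<^sup>2 * v ^ 3" using n by (simp add: power2_eq_square power3_eq_cube mult_ac)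
  then show ?thesis using that by blast
qed

text \<open>
  By the decomposition, the sum is dominated by the product of the series of \<open>u powr - (2 * t)\<close>
  and \<open>v powr - (3 * t)\<close>. The first of them is the reason for the exponent \<open>1/2\<close>.
\<close>

lemma summable_powerful_powr:
  fixes t :: real
  assumes t: "t > 1/2"
  shows "summable (\<lambda>n. if powerful n then real n powr - t else 0)"
proof (rule bounded_imp_summable)
  have s2: "summable (\<lambda>n. real n powr - (2 * t))"
    using t by (subst summable_real_powr_iff) auto
  have s3: "summable (\<lambda>n. real n powr - (3 * t))"
    using t by (subst summable_real_powr_iff) auto
  show "(\<Sum>n\<le>N. if powerful n then real n powr - t else 0) \<le>
      (\<Sum>n. real n powr - (2 * t)) * (\<Sum>n. real n powr - (3 * t))" for N
  proof -
    define h :: "nat \<times> nat \<Rightarrow> nat" where "h = (\<lambda>(u, v). u\<^sup>2 * v ^ 3)"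
    let ?I = "{..N} \<times> {..N}"
    have "{n. n \<le> N \<and> powerful n} \<subseteq> h ` ?I"
    proof
      fix n assume "n \<in> {n. n \<le> N \<and> powerful n}"
      then have n: "n \<le> N" "powerful n" by auto
      obtain u v where uv: "n = u\<^sup>2 * v ^ 3" using powerful_decompose[OF n(2)] .
      have "n > 0" using n by (simp add: powerful_def)
      then have "u > 0" "v > 0" using uv by (auto intro!: Nat.gr0I)
      have "u dvd n" "v dvd n" unfolding uv by (auto simp: power2_eq_square power3_eq_cube)
      then have "u \<le> n" "v \<le> n" using \<open>n > 0\<close> by (auto dest: dvd_imp_le)
      then have "(u, v) \<in> ?I" "n = h (u, v)" using n uv by (auto simp: h_def)
      then show "n \<in> h ` ?I" by blast
    qed
    then have "(\<Sum>n | n \<le> N \<and> powerful n. real n powr - t) \<le> (\<Sum>n\<in>h ` ?I. real n powr - t)"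
      by (intro sum_mono2) auto
    also have "\<dots> \<le> (\<Sum>x\<in>?I. real (h x) powr - t)"
      using sum_image_le[of ?I "\<lambda>n. real n powr - t" h] by (simp add: o_def)
    also have "\<dots> = (\<Sum>(u, v)\<in>?I. real u powr - (2 * t) * real v powr - (3 * t))"
    proof (rule sum.cong, simp, clarsimp simp: h_def)
      fix u v :: nat
      have "(real u)\<^sup>2 powr - t = real u powr - (2 * t)"
        by (cases "u = 0") (simp_all add: powr_powr flip: powr_numeral)
      moreover have "((real v)^3) powr - t = real v powr - (3 * t)"
        by (cases "v = 0") (simp_all add: powr_powr flip: powr_numeral)
      ultimately show "((real u)\<^sup>2 * real v ^ 3) powr - t = real u powr - (2 * t) * real v powr - (3 * t)"
        by (simp add: powr_mult)
    qed
    also have "\<dots> = (\<Sum>u\<le>N. real u powr - (2 * t)) * (\<Sum>v\<le>N. real v powr - (3 * t))"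
      by (simp add: sum_product sum.cartesian_product)
    also have "\<dots> \<le> (\<Sum>n. real n powr - (2 * t)) * (\<Sum>n. real n powr - (3 * t))"
      using s2 s3 by (intro mult_mono sum_le_suminf suminf_nonneg sum_nonneg) auto
    finally show ?thesis
      by (simp add: sum.If_cases Int_def)
  qed
qed auto

text \<open>
  All primes \<open>p \<ge> b powr (1 / \<delta>)\<close> satisfy \<open>b \<le> p powr \<delta>\<close>, so their contribution to the left-hand
  side is at most \<open>n powr \<delta>\<close>; the boundedly many smaller primes go into the constant.
\<close>

lemma power_card_prime_factors_le_powr:
  fixes b \<delta> :: real
  assumes b: "b \<ge> 1" and \<delta>: "\<delta> > 0"
  shows "\<exists>C>0. \<forall>n>0. b ^ card (prime_factors n) \<le> C * real n powr \<delta>"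
proof -
  define B where "B = nat \<lceil>b powr (1 / \<delta>)\<rceil>"
  have B: "b \<le> real p powr \<delta>" if "B \<le> p" for p
  proof -
    have "b powr (1 / \<delta>) \<le> real p" using that unfolding B_def by linarith
    then have "(b powr (1 / \<delta>)) powr \<delta> \<le> real p powr \<delta>"
      using \<delta> by (intro powr_mono2) auto
    then show ?thesis using b \<delta> by (simp add: powr_powr)
  qed
  have "b ^ card (prime_factors n) \<le> b ^ B * real n powr \<delta>" if n: "n > 0" for n
  proof -
    define P where "P = prime_factors n"
    define Q where "Q = P - {..<B}"
    have fin: "finite P" "finite Q" by (auto simp: P_def Q_def)
    have "card P = card (P \<inter> {..<B}) + card Q"
      unfolding Q_def using fin by (simp add: card_Int_Diff)
    then have "b ^ card P = b ^ card (P \<inter> {..<B}) * b ^ card Q"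
      by (simp add: power_add)
    also have "\<dots> \<le> b ^ B * real n powr \<delta>"
    proof (rule mult_mono)
      have "card (P \<inter> {..<B}) \<le> card {..<B}" by (rule card_mono) auto
      then show "b ^ card (P \<inter> {..<B}) \<le> b ^ B"
        using b by (intro power_increasing) auto
      have "b ^ card Q = (\<Prod>p\<in>Q. b)" by simp
      also have "\<dots> \<le> (\<Prod>p\<in>Q. real p powr \<delta>)"
        using b B by (intro prod_mono) (auto simp: Q_def)
      also have "\<dots> = real (\<Prod>Q) powr \<delta>"
        by (simp add: prod_powr_distrib)
      also have "\<dots> \<le> real n powr \<delta>"
      proof (rule powr_mono2)
        have "Q \<subseteq> prime_factors n" by (auto simp: Q_def P_def)
        then show "real (\<Prod>Q) \<le> real n"
          using n prod_prime_factors_subset_dvd[of Q n] by (simp only: of_nat_le_iff dvd_imp_le)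
      qed (use \<delta> in \<open>auto intro: prod_nonneg\<close>)
      finally show "b ^ card Q \<le> real n powr \<delta>" .
    qed (use b in auto)
    finally show ?thesis by (simp add: P_def)
  qed
  moreover have "b ^ B > 0" using b by simp
  ultimately show ?thesis by blast
qed

text \<open>
  A multiple of this weight will dominate the Moebius transforms of all admissible functions
  at once, which makes the error terms uniform.
\<close>

definition powerful_weight :: "real \<Rightarrow> nat \<Rightarrow> real" where
  "powerful_weight b n = (if powerful n then b ^ card (prime_factors n) else 0)"

lemma powerful_weight_nonneg: "b \<ge> 0 \<Longrightarrow> powerful_weight b n \<ge> 0"
  by (simp add: powerful_weight_def)

lemma summable_powerful_weight:
  fixes b t :: real
  assumes b: "b \<ge> 1" and t: "t > 1/2"
  shows "summable (\<lambda>n. powerful_weight b n * real n powr - t)"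
proof -
  \<comment> \<open>Half of the room above \<open>1/2\<close> absorbs the factor \<open>b ^ \<omega>(n)\<close>.\<close>
  define \<delta> where "\<delta> = (t - 1/2) / 2"
  have \<delta>: "\<delta> > 0" "t - \<delta> > 1/2" using t by (auto simp: \<delta>_def field_simps)
  obtain C where C: "C > 0" "\<And>n. n > 0 \<Longrightarrow> b ^ card (prime_factors n) \<le> C * real n powr \<delta>"
    using power_card_prime_factors_le_powr[OF b \<delta>(1)] by blast
  show ?thesis
  proof (rule summable_comparison_test')
    show "summable (\<lambda>n. C * (if powerful n then real n powr - (t - \<delta>) else 0))"
      using \<delta> by (intro summable_mult summable_powerful_powr)
    show "norm (powerful_weight b n * real n powr - t)
       \<le> C * (if powerful n then real n powr - (t - \<delta>) else 0)" for n
    proof (cases "powerful n")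
      case True
      then have "n > 0" by (simp add: powerful_def)
      then have "b ^ card (prime_factors n) * real n powr - t \<le> (C * real n powr \<delta>) * real n powr - t"
        using C by (intro mult_right_mono) auto
      also have "\<dots> = C * real n powr - (t - \<delta>)"
        by (simp add: powr_add[symmetric])
      finally show ?thesis using True b by (simp add: powerful_weight_def)
    qed (simp add: powerful_weight_def)
  qed
qed

section \<open>Summatory functions of divisor sums\<close>

lemma card_multiples_upto:
  assumes "x \<ge> 0" "d > 0"
  shows "card {n. 1 \<le> n \<and> real n \<le> x \<and> d dvd n} = nat \<lfloor>x / real d\<rfloor>"
proof -
  have "{n. 1 \<le> n \<and> real n \<le> x \<and> d dvd n} = (\<lambda>k. d * k) ` {1..nat \<lfloor>x / real d\<rfloor>}"
  proof (intro set_eqI iffI)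
    fix n assume "n \<in> {n. 1 \<le> n \<and> real n \<le> x \<and> d dvd n}"
    then obtain k where k: "n = d * k" "1 \<le> n" "real n \<le> x" by auto
    have "1 \<le> k" using k by (auto simp: Suc_le_eq intro!: Nat.gr0I)
    have "real k \<le> x / real d" using k assms by (simp add: field_simps)
    then have "k \<le> nat \<lfloor>x / real d\<rfloor>" using \<open>1 \<le> k\<close> by (simp add: le_nat_iff le_floor_iff)
    then show "n \<in> (\<lambda>k. d * k) ` {1..nat \<lfloor>x / real d\<rfloor>}" using k \<open>1 \<le> k\<close> by auto
  next
    fix n assume "n \<in> (\<lambda>k. d * k) ` {1..nat \<lfloor>x / real d\<rfloor>}"
    then obtain k where k: "n = d * k" "1 \<le> k" "k \<le> nat \<lfloor>x / real d\<rfloor>"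
      using assms by auto
    then have "real k \<le> x / real d" using assms by (simp add: le_nat_iff le_floor_iff)
    then show "n \<in> {n. 1 \<le> n \<and> real n \<le> x \<and> d dvd n}"
      using k assms by (auto simp: field_simps)
  qed
  moreover have "inj_on (\<lambda>k. d * k) {1..nat \<lfloor>x / real d\<rfloor>}"
    using assms by (auto simp: inj_on_def)
  ultimately show ?thesis by (simp add: card_image)
qed

text \<open>
  This treats large and small \<open>y\<close> together: for \<open>y \<ge> 1\<close> the left-hand side is at most 1, and for
  \<open>y < 1\<close> it equals \<open>y\<close>. No truncation at \<open>d \<le> x\<close> is therefore needed when \<open>y = x / d\<close>.
\<close>

lemma abs_floor_diff_le_powr:
  fixes y t :: real
  assumes "y \<ge> 0" "0 \<le> t" "t \<le> 1"
  shows "\<bar>of_int \<lfloor>y\<rfloor> - y\<bar> \<le> y powr t"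
proof (cases "y < 1")
  case True
  show ?thesis
  proof (cases "y = 0")
    case False
    then have "\<lfloor>y\<rfloor> = 0" using True assms by (simp add: floor_eq_iff)
    moreover have "y powr 1 \<le> y powr t"
      using True assms False by (intro powr_mono') auto
    ultimately show ?thesis using assms False by simp
  qed simp
next
  case False
  then have "1 \<le> y powr t" using assms by (intro ge_one_powr_ge_zero) auto
  moreover have "\<bar>of_int \<lfloor>y\<rfloor> - y\<bar> \<le> 1" by linarith
  ultimately show ?thesis by linarith
qed

lemma finite_nat_le_real: "finite {n :: nat. 1 \<le> n \<and> real n \<le> x}"
  by (rule finite_subset[of _ "{..nat \<lfloor>x\<rfloor>}"]) (auto simp: le_nat_floor)

text \<open>
  Exchanging the summations gives the sum of \<open>\<lfloor>x / d\<rfloor> * g d\<close> over all \<open>d\<close>, in which \<open>\<lfloor>x / d\<rfloor>\<close> is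
  replaced by \<open>x / d\<close> at the cost of at most \<open>norm (g d) * (x / d) powr t\<close>.
\<close>

lemma sum_divisor_sums_asymptotic:
  fixes g :: "nat \<Rightarrow> 'a :: {real_normed_field, banach}" and t x :: real
  assumes t: "0 \<le> t" "t \<le> 1" and x: "x \<ge> 1"
  assumes sm: "summable (\<lambda>d. norm (g d) * real d powr - t)"
  shows "norm ((\<Sum>n | 1 \<le> n \<and> real n \<le> x. \<Sum>d | d dvd n. g d) - (\<Sum>d. g d / of_nat d) * of_real x)
         \<le> (\<Sum>d. norm (g d) * real d powr - t) * x powr t"
proof -
  let ?X = "{n :: nat. 1 \<le> n \<and> real n \<le> x}"
  have finX: "finite ?X" by (rule finite_nat_le_real)
  \<comment> \<open>These terms vanish also for \<open>d = 0\<close>, because \<open>x / 0 = 0\<close>.\<close>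
  have floor0: "\<lfloor>x / real d\<rfloor> = 0" if "d \<notin> ?X" for d
    using that x by (cases "d = 0") (auto simp: floor_eq_iff)
  have "(\<Sum>n\<in>?X. \<Sum>d | d dvd n. g d) = (\<Sum>n\<in>?X. \<Sum>d | d \<in> ?X \<and> d dvd n. g d)"
  proof (intro sum.cong refl)
    fix n assume n: "n \<in> ?X"
    have "d \<in> ?X" if "d dvd n" for d
    proof -
      have "d > 0" "d \<le> n" using that n by (auto intro!: dvd_imp_le Nat.gr0I)
      then show ?thesis using n by auto
    qed
    then show "{d. d dvd n} = {d. d \<in> ?X \<and> d dvd n}" by blast
  qed
  also have "\<dots> = (\<Sum>d\<in>?X. \<Sum>n | n \<in> ?X \<and> d dvd n. g d)"
    by (rule sum.swap_restrict) (use finX in auto)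
  also have "\<dots> = (\<Sum>d\<in>?X. of_int \<lfloor>x / real d\<rfloor> * g d)"
  proof (intro sum.cong refl)
    fix d assume "d \<in> ?X"
    then have "card {n. n \<in> ?X \<and> d dvd n} = nat \<lfloor>x / real d\<rfloor>"
      using card_multiples_upto[of x d] x by (simp add: conj_assoc)
    moreover have "\<lfloor>x / real d\<rfloor> \<ge> 0" using x by simp
    ultimately show "(\<Sum>n | n \<in> ?X \<and> d dvd n. g d) = of_int \<lfloor>x / real d\<rfloor> * g d"
      by (simp only: sum_constant of_nat_nat)
  qed
  finally have S: "(\<Sum>n\<in>?X. \<Sum>d | d dvd n. g d) = (\<Sum>d\<in>?X. of_int \<lfloor>x / real d\<rfloor> * g d)" .
  have sums1: "(\<lambda>d. of_int \<lfloor>x / real d\<rfloor> * g d) sums (\<Sum>d\<in>?X. of_int \<lfloor>x / real d\<rfloor> * g d)"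
    by (rule sums_finite[OF finX]) (use floor0 in auto)
  have "summable (\<lambda>d. g d / of_nat d)"
  proof (rule summable_comparison_test'[OF sm])
    fix d :: nat
    show "norm (g d / of_nat d) \<le> norm (g d) * real d powr - t"
    proof (cases "d = 0")
      case False
      then have "real d powr -1 \<le> real d powr -t" using t by (intro powr_mono) auto
      then show ?thesis using False
        by (simp add: norm_divide powr_minus divide_inverse norm_mult norm_inverse mult_left_mono)
    qed simp
  qed
  then have "(\<lambda>d. g d / of_nat d * of_real x) sums ((\<Sum>d. g d / of_nat d) * of_real x)"
    by (intro sums_mult2 summable_sums)
  from sums_diff[OF sums1 this]
  have sums2: "(\<lambda>d. of_int \<lfloor>x / real d\<rfloor> * g d - g d / of_nat d * of_real x) sums
      ((\<Sum>d\<in>?X. of_int \<lfloor>x / real d\<rfloor> * g d) - (\<Sum>d. g d / of_nat d) * of_real x)" .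
  have le: "norm (of_int \<lfloor>x / real d\<rfloor> * g d - g d / of_nat d * of_real x)
             \<le> norm (g d) * real d powr - t * x powr t" for d
  proof -
    have "of_int \<lfloor>x / real d\<rfloor> * g d - g d / of_nat d * of_real x =
          of_real (of_int \<lfloor>x / real d\<rfloor> - x / real d) * g d"
      by (simp add: algebra_simps)
    then have "norm (of_int \<lfloor>x / real d\<rfloor> * g d - g d / of_nat d * of_real x) =
          \<bar>of_int \<lfloor>x / real d\<rfloor> - x / real d\<bar> * norm (g d)"
      by (simp only: norm_mult norm_of_real)
    also have "\<dots> \<le> (x / real d) powr t * norm (g d)"
      using x t by (intro mult_right_mono abs_floor_diff_le_powr) auto
    also have "(x / real d) powr t = real d powr - t * x powr t"
      using x by (simp add: powr_divide powr_minus field_simps)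
    finally show ?thesis by (simp add: mult_ac)
  qed
  have sums3: "(\<lambda>d. norm (g d) * real d powr - t * x powr t) sums
      ((\<Sum>d. norm (g d) * real d powr - t) * x powr t)"
    using sm by (intro sums_mult2 summable_sums)
  show ?thesis
    unfolding S sums_unique[OF sums2] sums_unique[OF sums3]
    by (rule norm_suminf_le) (use le sums_summable[OF sums3] in auto)
qed

section \<open>Sets of exponents\<close>

definition exponents :: "nat \<Rightarrow> nat set" where
  "exponents n = (\<lambda>p. multiplicity p n) ` prime_factors n"

text \<open>
  Counting the exponent 1 whether or not it occurs makes the count insensitive to primes that
  divide \<open>n\<close> exactly once, as \<open>moebius_transform_eq_0\<close> requires.
\<close>

definition exponents1_count :: "nat \<Rightarrow> nat" where
  "exponents1_count n = card (insert 1 (exponents n))"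

lemma finite_exponents [simp]: "finite (exponents n)"
  by (simp add: exponents_def)

lemma exponents_mult_coprime:
  assumes "coprime m n" "m > 0" "n > 0"
  shows "exponents (m * n) = exponents m \<union> exponents n"
proof -
  have *: "multiplicity p (m * n) = multiplicity p m + multiplicity p n" if "prime p" for p
    using that assms by (simp add: prime_elem_multiplicity_mult_distrib)
  have z: "multiplicity p n = 0" if "p \<in> prime_factors m" for p
    using that assms(1) by (metis coprime_common_divisor in_prime_factors_iff
        not_dvd_imp_multiplicity_0 not_prime_unit)
  have z': "multiplicity p m = 0" if "p \<in> prime_factors n" for p
    using that assms(1) by (metis coprime_common_divisor in_prime_factors_iff
        not_dvd_imp_multiplicity_0 not_prime_unit)
  have "prime_factors (m * n) = prime_factors m \<union> prime_factors n"
    using assms by (simp add: prime_factors_product)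
  then show ?thesis
    unfolding exponents_def using * z z'
    by (simp only: image_Un, intro arg_cong2[of _ _ _ _ "(\<union>)"] image_cong) (auto simp: in_prime_factors_imp_prime)
qed

lemma exponents_squarefree: "squarefree m \<Longrightarrow> exponents m \<subseteq> {1}"
  by (cases "m = 0") (auto simp: exponents_def squarefree_factorial_semiring')

lemma insert_1_exponents_mult_squarefree:
  assumes "squarefree m" "coprime m n" "n > 0"
  shows "insert 1 (exponents (m * n)) = insert 1 (exponents n)"
proof -
  have "m > 0" using assms(1) by (auto intro!: Nat.gr0I)
  then show ?thesis
    using exponents_mult_coprime[OF assms(2) _ assms(3)] exponents_squarefree[OF assms(1)] by auto
qed

lemma exponents1_count_mult_prime:
  assumes "prime p" "n > 0" "\<not> p dvd n"
  shows "exponents1_count (p * n) = exponents1_count n"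
  using assms insert_1_exponents_mult_squarefree[of p n]
  by (simp add: exponents1_count_def squarefree_prime prime_imp_coprime)

lemma num_distinct_exponents_eq: "num_distinct_exponents n = card (exponents n)"
  by (simp add: num_distinct_exponents_def exponents_def)

lemma num_distinct_exponents_le: "num_distinct_exponents n \<le> card (prime_factors n)"
  unfolding num_distinct_exponents_def by (rule card_image_le) auto

lemma exponents1_count_le: "exponents1_count n \<le> Suc (card (prime_factors n))"
  using num_distinct_exponents_le[of n]
  by (simp add: exponents1_count_def num_distinct_exponents_eq card_insert_if)

lemma exponents1_count_pos: "exponents1_count n > 0"
  by (simp add: exponents1_count_def card_gt_0_iff)

lemma num_distinct_exponents_not_powerful:
  assumes "\<not> powerful n" "n > 0"
  shows "num_distinct_exponents n = exponents1_count n"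
proof -
  obtain p where p: "prime p" "p dvd n" "\<not> p\<^sup>2 dvd n"
    using assms by (auto simp: powerful_def)
  then have "multiplicity p n = 1"
    by (intro multiplicity_eqI) (auto simp: power2_eq_square)
  then have "1 \<in> exponents n"
    unfolding exponents_def using p assms by (intro rev_image_eqI[of p]) (auto intro: prime_factorsI)
  then show ?thesis
    by (simp add: exponents1_count_def num_distinct_exponents_eq insert_absorb)
qed

section \<open>Mean values of functions of the exponent count\<close>

definition mean_value :: "(nat \<Rightarrow> 'a :: {real_normed_field, banach}) \<Rightarrow> 'a" where
  "mean_value \<phi> = (\<Sum>d. moebius_transform (\<lambda>n. \<phi> (exponents1_count n)) d / of_nat d)"

lemma card_prime_factors_mono:
  fixes m n :: nat
  assumes "m dvd n" "n > 0"
  shows "card (prime_factors m) \<le> card (prime_factors n)"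
  using assms by (intro card_mono dvd_prime_factors) auto

text \<open>
  There are \<open>2 ^ \<omega>(n)\<close> terms, where \<open>\<omega>(n)\<close> is the number of primes dividing \<open>n\<close>, and each is
  bounded by \<open>a ^ (\<omega>(n) + 1)\<close>, because a divisor of \<open>n\<close> has at most \<open>\<omega>(n)\<close> different exponents.
\<close>

lemma norm_transform_le_weight:
  fixes \<phi> :: "nat \<Rightarrow> 'a :: real_normed_field"
  assumes a: "a \<ge> 1" and \<phi>: "\<And>k. norm (\<phi> k) \<le> a ^ k" and n: "n > 0"
  shows "norm (moebius_transform (\<lambda>n. \<phi> (exponents1_count n)) n) \<le> a * powerful_weight (2 * a) n"
proof (cases "powerful n")
  case True
  have "norm (moebius_transform (\<lambda>n. \<phi> (exponents1_count n)) n) \<le>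
      2 ^ card (prime_factors n) * a ^ Suc (card (prime_factors n))"
  proof (rule norm_moebius_transform_le)
    fix m assume "m dvd n"
    then have "exponents1_count m \<le> Suc (card (prime_factors n))"
      using exponents1_count_le[of m] card_prime_factors_mono[of m n] n by simp
    then have "a ^ exponents1_count m \<le> a ^ Suc (card (prime_factors n))"
      using a by (intro power_increasing) auto
    then show "norm (\<phi> (exponents1_count m)) \<le> a ^ Suc (card (prime_factors n))"
      using \<phi>[of "exponents1_count m"] by linarith
  qed
  also have "\<dots> = a * powerful_weight (2 * a) n"
    using True by (simp add: powerful_weight_def power_mult_distrib)
  finally show ?thesis .
next
  case False
  then show ?thesis
    using n by (simp add: moebius_transform_eq_0 exponents1_count_mult_prime powerful_weight_def)
qed

lemma norm_transform_powr_le: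
  fixes \<phi> :: "nat \<Rightarrow> 'a :: real_normed_field"
  assumes a: "a \<ge> 1" and \<phi>: "\<And>k. norm (\<phi> k) \<le> a ^ k"
  shows "norm (moebius_transform (\<lambda>n. \<phi> (exponents1_count n)) n) * real n powr - t
      \<le> a * (powerful_weight (2 * a) n * real n powr - t)"
  using norm_transform_le_weight[OF assms, of n]
  by (cases "n = 0") (auto simp: mult.assoc[symmetric] intro!: mult_right_mono)

lemma norm_transform_div_le:
  fixes \<phi> :: "nat \<Rightarrow> 'a :: real_normed_field"
  assumes a: "a \<ge> 1" and \<phi>: "\<And>k. norm (\<phi> k) \<le> a ^ k"
  shows "norm (moebius_transform (\<lambda>n. \<phi> (exponents1_count n)) d / of_nat d)
      \<le> a * (powerful_weight (2 * a) d * real d powr - 1)"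
  using norm_transform_powr_le[OF assms, of d 1]
  by (cases "d = 0") (simp_all add: norm_divide powr_minus field_simps)

lemma sum_exponents1_count_asymptotic:
  fixes \<phi> :: "nat \<Rightarrow> 'a :: {real_normed_field, banach}"
  assumes a: "a \<ge> 1" and \<phi>: "\<And>k. norm (\<phi> k) \<le> a ^ k"
    and t: "1/2 < t" "t \<le> 1" and x: "x \<ge> 1"
  shows "norm ((\<Sum>n | 1 \<le> n \<and> real n \<le> x. \<phi> (exponents1_count n)) - mean_value \<phi> * of_real x)
         \<le> a * (\<Sum>n. powerful_weight (2 * a) n * real n powr - t) * x powr t"
proof -
  define g where "g = moebius_transform (\<lambda>n. \<phi> (exponents1_count n))"
  have sw: "summable (\<lambda>n. a * (powerful_weight (2 * a) n * real n powr - t))"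
    using a t by (intro summable_mult summable_powerful_weight) auto
  have le: "norm (g n) * real n powr - t \<le> a * (powerful_weight (2 * a) n * real n powr - t)" for n
    unfolding g_def by (rule norm_transform_powr_le) fact+
  have sg: "summable (\<lambda>n. norm (g n) * real n powr - t)"
    by (rule summable_comparison_test'[OF sw]) (use le in auto)
  have "(\<Sum>n | 1 \<le> n \<and> real n \<le> x. \<phi> (exponents1_count n)) =
      (\<Sum>n | 1 \<le> n \<and> real n \<le> x. \<Sum>d | d dvd n. g d)"
    unfolding g_def by (intro sum.cong refl) (simp add: moebius_inversion)
  also have "norm (\<dots> - mean_value \<phi> * of_real x) \<le> (\<Sum>d. norm (g d) * real d powr - t) * x powr t"
    unfolding mean_value_def g_def[symmetric]
    using t x sg by (intro sum_divisor_sums_asymptotic) auto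
  also have "\<dots> \<le> (\<Sum>n. a * (powerful_weight (2 * a) n * real n powr - t)) * x powr t"
    using sg sw le by (intro mult_right_mono suminf_le) auto
  also have "(\<Sum>n. a * (powerful_weight (2 * a) n * real n powr - t)) =
      a * (\<Sum>n. powerful_weight (2 * a) n * real n powr - t)"
    using a t by (intro suminf_mult summable_powerful_weight) auto
  finally show ?thesis .
qed

text \<open>
  The two counts differ only at powerful numbers, and there \<open>1 \<le> (x / n) powr t\<close>. So replacing
  one count by the other costs at most twice the bound already obtained for the error.
\<close>

lemma sum_num_distinct_exponents_asymptotic:
  fixes \<phi> :: "nat \<Rightarrow> 'a :: {real_normed_field, banach}"
  assumes a: "a \<ge> 1" and \<phi>: "\<And>k. norm (\<phi> k) \<le> a ^ k"
    and t: "1/2 < t" "t \<le> 1" and x: "x \<ge> 1"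
  shows "norm ((\<Sum>n | 1 \<le> n \<and> real n \<le> x. \<phi> (num_distinct_exponents n)) - mean_value \<phi> * of_real x)
         \<le> 3 * a * (\<Sum>n. powerful_weight (2 * a) n * real n powr - t) * x powr t"
proof -
  let ?X = "{n :: nat. 1 \<le> n \<and> real n \<le> x}"
  let ?W = "\<lambda>n. powerful_weight (2 * a) n * real n powr - t"
  have sw: "summable ?W" using a t by (intro summable_powerful_weight) auto
  have "norm ((\<Sum>n\<in>?X. \<phi> (num_distinct_exponents n)) - (\<Sum>n\<in>?X. \<phi> (exponents1_count n)))
      \<le> (\<Sum>n\<in>?X. 2 * a * x powr t * ?W n)"
    unfolding sum_subtractf[symmetric]
  proof (rule sum_norm_le)
    fix n assume n: "n \<in> ?X"
    show "norm (\<phi> (num_distinct_exponents n) - \<phi> (exponents1_count n)) \<le> 2 * a * x powr t * ?W n"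
    proof (cases "powerful n")
      case True
      have *: "norm (\<phi> j) \<le> a * (2 * a) ^ card (prime_factors n)"
        if "j \<le> Suc (card (prime_factors n))" for j
      proof -
        have "norm (\<phi> j) \<le> a ^ j" by (rule \<phi>)
        also have "\<dots> \<le> a ^ Suc (card (prime_factors n))"
          using that a by (intro power_increasing) auto
        also have "\<dots> \<le> a * (2 * a) ^ card (prime_factors n)"
          using a by (auto intro!: mult_left_mono power_mono)
        finally show ?thesis .
      qed
      have "norm (\<phi> (num_distinct_exponents n) - \<phi> (exponents1_count n)) \<le>
          norm (\<phi> (num_distinct_exponents n)) + norm (\<phi> (exponents1_count n))"
        by (rule norm_triangle_ineq4)
      also have "\<dots> \<le> 2 * (a * (2 * a) ^ card (prime_factors n))"
        using *[OF exponents1_count_le] *[OF le_SucI[OF num_distinct_exponents_le]] by linarith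
      also have "\<dots> = 2 * a * powerful_weight (2 * a) n * 1"
        using True by (simp add: powerful_weight_def)
      also have "\<dots> \<le> 2 * a * powerful_weight (2 * a) n * (x powr t * real n powr - t)"
      proof (rule mult_left_mono)
        have "real n powr t \<le> x powr t" using n t by (intro powr_mono2) auto
        then show "1 \<le> x powr t * real n powr - t"
          using n by (simp add: powr_minus field_simps)
      qed (use a powerful_weight_nonneg[of "2 * a" n] in auto)
      finally show ?thesis by (simp add: mult_ac)
    next
      case False
      then show ?thesis
        using n num_distinct_exponents_not_powerful[of n] by (simp add: powerful_weight_def)
    qed
  qed
  also have "\<dots> = 2 * a * x powr t * (\<Sum>n\<in>?X. ?W n)"
    by (simp add: sum_distrib_left)
  also have "\<dots> \<le> 2 * a * x powr t * (\<Sum>n. ?W n)"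
    using a by (intro mult_left_mono sum_le_suminf sw finite_nat_le_real)
      (auto simp: powerful_weight_nonneg)
  finally show ?thesis
    using sum_exponents1_count_asymptotic[OF assms]
      norm_triangle_ineq[of "(\<Sum>n\<in>?X. \<phi> (num_distinct_exponents n)) - (\<Sum>n\<in>?X. \<phi> (exponents1_count n))"
        "(\<Sum>n\<in>?X. \<phi> (exponents1_count n)) - mean_value \<phi> * of_real x"]
    by (simp add: algebra_simps)
qed

section \<open>The densities of the levels\<close>

text \<open>
  The natural density of the set of \<open>n\<close> with \<open>exponents1_count n = k\<close>.
\<close>

definition level_density :: "nat \<Rightarrow> real" where
  "level_density k = mean_value (\<lambda>j. of_bool (j = k))"

lemma moebius_transform_of_real:
  "moebius_transform (\<lambda>n. of_real (F n)) d =
     (of_real (moebius_transform F d) :: 'a :: {comm_ring_1, real_algebra_1})"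
  by (simp add: moebius_transform_def)

lemma moebius_transform_lincomb:
  "moebius_transform (\<lambda>n. \<Sum>j\<in>J. c j * F j n) d = (\<Sum>j\<in>J. c j * moebius_transform (F j) d)"
  unfolding moebius_transform_def sum_distrib_left
  by (subst sum.swap) (simp add: mult_ac)

lemma moebius_transform_cong:
  assumes "d > 0" "\<And>n. n dvd d \<Longrightarrow> F n = G n"
  shows "moebius_transform F d = moebius_transform G d"
  unfolding moebius_transform_def
proof (intro sum.cong refl)
  fix S assume "S \<in> Pow (prime_factors d)"
  then have "d div \<Prod>S dvd d"
    using prod_prime_factors_subset_dvd[of S d] by (auto elim!: dvdE)
  then show "(-1) ^ card S * F (d div \<Prod>S) = (-1) ^ card S * G (d div \<Prod>S)"
    using assms by simp
qed

lemma summable_transform: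
  fixes \<phi> :: "nat \<Rightarrow> 'a :: {real_normed_field, banach}"
  assumes a: "a \<ge> 1" and \<phi>: "\<And>k. norm (\<phi> k) \<le> a ^ k"
  shows "summable (\<lambda>d. moebius_transform (\<lambda>n. \<phi> (exponents1_count n)) d / of_nat d)"
proof (rule summable_comparison_test')
  show "summable (\<lambda>n. a * (powerful_weight (2 * a) n * real n powr - 1))"
    using a by (intro summable_mult summable_powerful_weight) auto
  show "norm (moebius_transform (\<lambda>n. \<phi> (exponents1_count n)) d / of_nat d)
      \<le> a * (powerful_weight (2 * a) d * real d powr - 1)" for d
    by (rule norm_transform_div_le[OF assms])
qed

text \<open>
  For \<open>\<phi>\<close> truncated to the arguments \<open>1, \<dots>, K\<close>, the claim is linearity of the mean value. The
  truncation leaves the transform at \<open>d\<close> unchanged once \<open>K\<close> exceeds the number of primes dividing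
  \<open>d\<close>, and it keeps the bound by the powerful weight, so Tannery's theorem allows \<open>K\<close> to tend to
  infinity.
\<close>

lemma level_density_sums:
  fixes \<phi> :: "nat \<Rightarrow> 'a :: {real_normed_field, banach}"
  assumes a: "a \<ge> 1" and \<phi>: "\<And>k. norm (\<phi> k) \<le> a ^ k"
  shows "(\<lambda>k. of_real (level_density (Suc k)) * \<phi> (Suc k)) sums mean_value \<phi>"
proof -
  define \<phi>t where "\<phi>t K j = (if 1 \<le> j \<and> j \<le> K then \<phi> j else 0)" for K j
  define g where "g K d = moebius_transform (\<lambda>n. \<phi>t K (exponents1_count n)) d / of_nat d" for K d
  have \<phi>t_bound: "norm (\<phi>t K j) \<le> a ^ j" for K j
    using \<phi>[of j] a by (auto simp: \<phi>t_def)
  have \<phi>t_sum: "\<phi>t K j = (\<Sum>k<K. \<phi> (Suc k) * of_real (of_bool (j = Suc k)))" for K j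
  proof (cases "1 \<le> j \<and> j \<le> K")
    case True
    then obtain i where i: "j = Suc i" "i < K" by (cases j) auto
    have "(\<Sum>k<K. \<phi> (Suc k) * of_real (of_bool (j = Suc k))) = (\<Sum>k<K. if k = i then \<phi> (Suc k) else 0)"
      using i by (intro sum.cong) auto
    then show ?thesis using i by (simp add: \<phi>t_def)
  next
    case False
    then show ?thesis by (auto simp: \<phi>t_def intro!: sum.neutral[symmetric])
  qed
  have one: "norm (of_bool (j = k) :: real) \<le> 1 ^ j" for j k :: nat by simp
  have partial: "(\<Sum>d. g K d) = (\<Sum>k<K. of_real (level_density (Suc k)) * \<phi> (Suc k))" for K
  proof -
    define h where "h k d = moebius_transform (\<lambda>n. of_bool (exponents1_count n = Suc k) :: real) d / of_nat d" for k d
    have h: "summable (h k)" "(\<Sum>d. h k d) = level_density (Suc k)" for k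
      using summable_transform[of 1 "\<lambda>j. of_bool (j = Suc k) :: real"] one
      by (auto simp: h_def[abs_def] level_density_def mean_value_def)
    have "g K d = (\<Sum>k<K. \<phi> (Suc k) * of_real (h k d))" for d
      unfolding g_def \<phi>t_sum moebius_transform_lincomb moebius_transform_of_real h_def
      by (simp add: sum_divide_distrib)
    then have "(\<Sum>d. g K d) = (\<Sum>d. \<Sum>k<K. \<phi> (Suc k) * of_real (h k d))" by simp
    also have "\<dots> = (\<Sum>k<K. \<Sum>d. \<phi> (Suc k) * of_real (h k d))"
      using h by (intro suminf_sum summable_mult summable_of_real)
    also have "\<dots> = (\<Sum>k<K. of_real (level_density (Suc k)) * \<phi> (Suc k))"
      using h by (simp add: suminf_mult summable_of_real suminf_of_real[symmetric] mult.commute)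
    finally show ?thesis .
  qed
  have "((\<lambda>K. \<Sum>d. g K d) \<longlongrightarrow> (\<Sum>d. moebius_transform (\<lambda>n. \<phi> (exponents1_count n)) d / of_nat d)) sequentially"
  proof (rule conjunct2[OF conjunct2[OF tannerys_theorem]])
    show "summable (\<lambda>n. a * (powerful_weight (2 * a) n * real n powr - 1))"
      using a by (intro summable_mult summable_powerful_weight) auto
    have "norm (g K d) \<le> a * (powerful_weight (2 * a) d * real d powr - 1)" for K d
      unfolding g_def by (rule norm_transform_div_le[OF a \<phi>t_bound])
    then show "eventually (\<lambda>(d, K). norm (g K d) \<le> a * (powerful_weight (2 * a) d * real d powr - 1))
        (at_top \<times>\<^sub>F sequentially)"
      by (intro always_eventually) auto
    show "((\<lambda>K. g K d) \<longlongrightarrow> moebius_transform (\<lambda>n. \<phi> (exponents1_count n)) d / of_nat d) sequentially" for d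
    proof (cases "d = 0")
      case False
      have "g K d = moebius_transform (\<lambda>n. \<phi> (exponents1_count n)) d / of_nat d"
        if K: "K \<ge> Suc (card (prime_factors d))" for K
        unfolding g_def
      proof (intro arg_cong2[where f = "(/)"] moebius_transform_cong refl)
        fix n assume "n dvd d"
        then show "\<phi>t K (exponents1_count n) = \<phi> (exponents1_count n)"
          using exponents1_count_le[of n] exponents1_count_pos[of n]
            card_prime_factors_mono[of n d] False K by (simp add: \<phi>t_def)
      qed (use False in auto)
      then show ?thesis
        by (intro tendsto_eventually eventually_sequentiallyI)
    qed (simp add: g_def)
  qed auto
  then show ?thesis
    unfolding sums_def mean_value_def partial .
qed

section \<open>Positivity of the densities\<close>

lemma exponents_prime_power:
  assumes "prime p" "k > 0"
  shows "exponents (p ^ k) = {k}"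
proof -
  have "prime_factors (p ^ k) = {p}"
    using assms by (simp add: prime_factorization_prime_power)
  then show ?thesis
    using assms by (simp add: exponents_def)
qed

text \<open>
  Take \<open>s = p\<^sub>1 * p\<^sub>2 ^ 2 * \<dots> * p\<^sub>k ^ k\<close> for distinct primes; for \<open>k = 1\<close> the empty product will do.
\<close>

lemma ex_exponents_eq_atLeastAtMost:
  assumes "k \<ge> 1"
  shows "\<exists>s>0. insert 1 (exponents s) = {1..k}"
  using assms
proof (induction k rule: dec_induct)
  case base
  have "exponents 1 = {}" by (simp add: exponents_def)
  then show ?case by (intro exI[of _ 1]) auto
next
  case (step k)
  then obtain s where s: "s > 0" "insert 1 (exponents s) = {1..k}" by auto
  obtain p where p: "prime p" "p > s" using bigger_prime[of s] by auto
  have "coprime (p ^ Suc k) s"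
    using p s by (intro coprime_power_left_iff[THEN iffD2] disjI1 prime_imp_coprime)
      (auto dest: dvd_imp_le)
  then have "exponents (p ^ Suc k * s) = {Suc k} \<union> exponents s"
    using p s exponents_prime_power[OF p(1), of "Suc k"]
    by (subst exponents_mult_coprime) (auto simp: prime_gt_0_nat)
  then have "insert 1 (exponents (p ^ Suc k * s)) = insert (Suc k) {1..k}"
    unfolding s(2)[symmetric] by auto
  also have "\<dots> = {1..Suc k}" by auto
  finally show ?case using p s by (intro exI[of _ "p ^ Suc k * s"]) (auto simp: prime_gt_0_nat)
qed

lemma card_residue_class_le:
  fixes q :: nat
  assumes "q > 0" "T \<subseteq> {..<J}" "\<And>i j. i \<in> T \<Longrightarrow> j \<in> T \<Longrightarrow> i mod q = j mod q"
  shows "card T \<le> J div q + 1"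
proof -
  have "inj_on (\<lambda>j. j div q) T"
    using assms(3) by (intro inj_onI) (metis div_mult_mod_eq)
  moreover have "(\<lambda>j. j div q) ` T \<subseteq> {..J div q}"
    using assms(2) by (auto intro!: div_le_mono simp: subset_iff less_imp_le)
  ultimately have "card T \<le> card {..J div q}" by (intro card_inj_on_le) auto
  then show ?thesis by simp
qed

lemma coprime_one_plus_mult: "coprime (1 + s * j) (s :: nat)"
proof (rule coprimeI)
  fix c assume "c dvd 1 + s * j" "c dvd s"
  then show "is_unit c" using dvd_add_left_iff[of c "s * j" 1] by auto
qed

text \<open>
  Telescoping with \<open>1 / d\<^sup>2 \<le> 1 / (d - 1) - 1 / d\<close> from \<open>d = 2\<close> on would only give the bound 1, which
  is useless for the counting below; keeping the term \<open>1/4\<close> and telescoping from \<open>d = 3\<close> on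
  gives \<open>3/4\<close>.
\<close>

lemma sum_inverse_squares_le: "(\<Sum>d\<in>{2..D}. 1 / real d ^ 2) \<le> 3/4"
proof -
  have upper: "(\<Sum>d\<in>{2..D}. 1 / real d ^ 2) \<le> 3/4 - 1 / real D" if "D \<ge> 2"
    using that
  proof (induction D rule: dec_induct)
    case (step D)
    have "1 / real (Suc D) ^ 2 \<le> 1 / real D - 1 / real (Suc D)"
    proof -
      have "1 / real (Suc D) ^ 2 \<le> 1 / (real D * real (Suc D))"
        using step by (intro divide_left_mono) (auto simp: power2_eq_square)
      also have "\<dots> = 1 / real D - 1 / real (Suc D)"
        using step by (simp add: field_simps)
      finally show ?thesis .
    qed
    then show ?case using step by simp
  qed simp
  show ?thesis
  proof (cases "D \<ge> 2")
    case True
    have "(\<Sum>d\<in>{2..D}. 1 / real d ^ 2) \<le> 3/4 - 1 / real D" using True by (rule upper)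
    also have "\<dots> \<le> 3/4" by simp
    finally show ?thesis .
  qed simp
qed

text \<open>
  A number \<open>1 + s * j\<close> that is not squarefree is divisible by \<open>d\<^sup>2\<close> for some \<open>d\<close> with
  \<open>2 \<le> d \<le> sqrt (1 + s * J)\<close>. As such a \<open>d\<close> is coprime to \<open>s\<close>, this puts \<open>j\<close> into one residue class
  modulo \<open>d\<^sup>2\<close>, so at most \<open>J / d\<^sup>2 + 1\<close> values of \<open>j\<close> are lost for each \<open>d\<close>. In total this is at
  most \<open>3/4 * J\<close> plus the number of possible \<open>d\<close>.
\<close>

lemma card_squarefree_progression_ge:
  fixes s J :: nat
  shows "real J / 4 - sqrt (1 + real s * real J) \<le> real (card {j. j < J \<and> squarefree (1 + s * j)})"
proof -
  define D where "D = nat \<lfloor>sqrt (1 + real s * real J)\<rfloor>"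
  define T where "T d = {j. j < J \<and> d\<^sup>2 dvd 1 + s * j}" for d
  define G where "G = {j. j < J \<and> squarefree (1 + s * j)}"
  have cardT: "real (card (T d)) \<le> real J * (1 / real d ^ 2) + 1" if d: "d \<in> {2..D}" for d
  proof -
    have *: "i mod d\<^sup>2 = j mod d\<^sup>2" if "i \<in> T d" "j \<in> T d" "i \<le> j" for i j
    proof -
      have "d\<^sup>2 dvd (1 + s * j) - (1 + s * i)"
        using that by (intro dvd_diff_nat) (auto simp: T_def)
      also have "(1 + s * j) - (1 + s * i) = s * (j - i)"
        by (simp add: diff_mult_distrib2)
      finally have dv: "d\<^sup>2 dvd s * (j - i)" .
      have "coprime (d\<^sup>2) s"
      proof (rule coprime_divisors[OF _ dvd_refl coprime_one_plus_mult])
        show "d\<^sup>2 dvd 1 + s * j" using that by (simp add: T_def)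
      qed
      then have "d\<^sup>2 dvd j - i" using dv by (simp add: coprime_dvd_mult_right_iff)
      then show ?thesis using that(3) using mod_eq_dvd_iff_nat[of i j "d\<^sup>2"] by simp
    qed
    have "card (T d) \<le> J div d\<^sup>2 + 1"
    proof (rule card_residue_class_le)
      show "i mod d\<^sup>2 = j mod d\<^sup>2" if "i \<in> T d" "j \<in> T d" for i j
        using that *[of i j] *[of j i, symmetric] by (cases i j rule: linorder_le_cases) blast+
    qed (use d in \<open>auto simp: T_def\<close>)
    then have "real (card (T d)) \<le> real (J div d\<^sup>2) + 1" by linarith
    also have "real (J div d\<^sup>2) \<le> real J / real (d\<^sup>2)" by (rule of_nat_div_le_of_nat)
    finally show ?thesis by simp
  qed
  have "{..<J} \<subseteq> G \<union> (\<Union>d\<in>{2..D}. T d)"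
  proof
    fix j assume j: "j \<in> {..<J}"
    show "j \<in> G \<union> (\<Union>d\<in>{2..D}. T d)"
    proof (cases "squarefree (1 + s * j)")
      case False
      then obtain d where d: "d\<^sup>2 dvd 1 + s * j" "\<not> is_unit d"
        by (auto simp: squarefree_def)
      have "d \<noteq> 0" using d(1) by (intro notI) simp
      then have "2 \<le> d" using d(2) by (cases d) auto
      have "d\<^sup>2 \<le> 1 + s * j" using d(1) by (intro dvd_imp_le) auto
      also have "\<dots> \<le> 1 + s * J" using j by simp
      finally have "real (d\<^sup>2) \<le> real (1 + s * J)" by (simp only: of_nat_le_iff)
      then have "real d \<le> sqrt (1 + real s * real J)" by (intro real_le_rsqrt) simp
      then have "d \<le> D" by (simp add: D_def le_nat_floor)
      then show ?thesis using \<open>2 \<le> d\<close> d(1) j by (auto simp: T_def)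
    qed (use j in \<open>auto simp: G_def\<close>)
  qed
  then have "card {..<J} \<le> card (G \<union> (\<Union>d\<in>{2..D}. T d))"
    by (intro card_mono) (auto simp: G_def T_def)
  also have "\<dots> \<le> card G + (\<Sum>d\<in>{2..D}. card (T d))"
    by (rule order_trans[OF card_Un_le]) (simp add: card_UN_le)
  finally have "real J \<le> real (card G) + (\<Sum>d\<in>{2..D}. real (card (T d)))"
    by (simp flip: of_nat_sum of_nat_add)
  also have "(\<Sum>d\<in>{2..D}. real (card (T d))) \<le> (\<Sum>d\<in>{2..D}. real J * (1 / real d ^ 2) + 1)"
    by (intro sum_mono cardT)
  also have "\<dots> = real J * (\<Sum>d\<in>{2..D}. 1 / real d ^ 2) + real (D - 1)"
    by (simp add: sum.distrib sum_distrib_left)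
  also have "\<dots> \<le> real J * (3/4) + sqrt (1 + real s * real J)"
  proof (intro add_mono mult_left_mono sum_inverse_squares_le)
    have "real (D - 1) \<le> real D" by simp
    also have "\<dots> \<le> sqrt (1 + real s * real J)" by (simp add: D_def)
    finally show "real (D - 1) \<le> sqrt (1 + real s * real J)" .
  qed auto
  finally show ?thesis by (simp add: G_def)
qed

text \<open>
  If \<open>s\<close> has exponents \<open>1, \<dots>, k\<close>, then multiplying it by a squarefree number coprime to it leaves
  the count \<open>k\<close> unchanged. The squarefree numbers \<open>1 + s * j\<close> with \<open>j < J\<close> thus give at least
  about \<open>J / 4\<close> integers of count \<open>k\<close> up to \<open>s * (1 + s * J)\<close>, whereas density zero would leave only
  the error term, of order \<open>J powr (3/4)\<close>.
\<close>

lemma level_density_pos: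
  assumes k: "k \<ge> 1"
  shows "level_density k > 0"
proof (rule ccontr)
  assume "\<not> level_density k > 0"
  then have neg: "level_density k \<le> 0" by simp
  obtain s where s: "s > 0" "insert 1 (exponents s) = {1..k}"
    using ex_exponents_eq_atLeastAtMost[OF k] by auto
  \<comment> \<open>The asymptotics for indicator functions, with \<open>a = 1\<close> and exponent \<open>3/4\<close>.\<close>
  define C where "C = 1 * (\<Sum>n. powerful_weight (2 * 1) n * real n powr - (3/4))"
  have bound: "real J / 4 - sqrt (1 + real s * real J) \<le> C * (real s * (1 + real s * real J)) powr (3/4)" for J
  proof -
    define x where "x = real s * (1 + real s * real J)"
    let ?X = "{n :: nat. 1 \<le> n \<and> real n \<le> x}"
    define G where "G = {j. j < J \<and> squarefree (1 + s * j)}"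
    have "real (s * 1) \<le> x"
      unfolding x_def of_nat_mult by (intro mult_left_mono) auto
    then have x: "x \<ge> 1" using s by simp
    have "inj_on (\<lambda>j. (1 + s * j) * s) G" using s by (auto simp: inj_on_def)
    then have "card G = card ((\<lambda>j. (1 + s * j) * s) ` G)" by (simp add: card_image)
    also have "\<dots> \<le> card {n \<in> ?X. exponents1_count n = k}"
    proof (rule card_mono)
      show "(\<lambda>j. (1 + s * j) * s) ` G \<subseteq> {n \<in> ?X. exponents1_count n = k}"
      proof (intro image_subsetI CollectI conjI)
        fix j assume j: "j \<in> G"
        have "coprime (1 + s * j) s" by (rule coprime_one_plus_mult)
        then have "insert 1 (exponents ((1 + s * j) * s)) = {1..k}"
          using insert_1_exponents_mult_squarefree[of "1 + s * j" s] j s by (simp add: G_def)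
        then show "exponents1_count ((1 + s * j) * s) = k"
          by (simp add: exponents1_count_def)
        have "(1 + s * j) * s \<le> s * (1 + s * J)" using j by (simp add: G_def)
        then have "real ((1 + s * j) * s) \<le> real (s * (1 + s * J))" by (simp only: of_nat_le_iff)
        also have "real (s * (1 + s * J)) = x" by (simp add: x_def algebra_simps)
        finally show "real ((1 + s * j) * s) \<le> x" .
      qed (use s in auto)
    qed (rule finite_subset[OF _ finite_nat_le_real[of x]], auto)
    also have "real \<dots> = (\<Sum>n\<in>?X. of_bool (exponents1_count n = k))"
      using finite_nat_le_real[of x] by (simp add: Int_def conj_commute)
    finally have "real (card G) \<le> (\<Sum>n\<in>?X. of_bool (exponents1_count n = k))" by simp
    moreover have "norm ((\<Sum>n\<in>?X. of_bool (exponents1_count n = k)) -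
        level_density k * x) \<le> C * x powr (3/4)"
      using sum_exponents1_count_asymptotic[of 1 "\<lambda>j. of_bool (j = k) :: real" "3/4" x] x
      by (simp add: C_def level_density_def)
    moreover have "level_density k * x \<le> 0" using neg x by (simp add: mult_nonpos_nonneg)
    ultimately have "real (card G) \<le> C * x powr (3/4)"
      by (simp add: abs_le_iff)
    then show ?thesis
      using card_squarefree_progression_ge[of J s] by (simp add: G_def x_def)
  qed
  have r: "real s > 0" using s by simp
  have "((\<lambda>J. sqrt (1 + real s * real J) / real J + C * ((real s * (1 + real s * real J)) powr (3/4) / real J)) \<longlongrightarrow> 0 + C * 0) sequentially"
    using r by (intro tendsto_intros; real_asymp)
  then have "eventually (\<lambda>J. sqrt (1 + real s * real J) / real J + C * ((real s * (1 + real s * real J)) powr (3/4) / real J) < 1/4) sequentially"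
    by (intro order_tendstoD) auto
  then have "eventually (\<lambda>J. False) sequentially"
    using eventually_gt_at_top[of 0]
  proof eventually_elim
    case (elim J)
    then show ?case using bound[of J] by (simp add: field_simps)
  qed
  then show False by simp
qed

section \<open>The mean value theorem for the number of distinct exponents\<close>

theorem theorem1p1:
  shows "\<exists>A :: nat \<Rightarrow> real. (\<forall>k\<ge>1. A k > 0) \<and>
    (\<forall>a::real. a > 1 \<longrightarrow>
      (\<forall>\<phi>. arithmetic_fun_bounded a \<phi> \<longrightarrow> summable (M_term A \<phi>)) \<and>
      (\<forall>\<epsilon>::real. \<epsilon> > 0 \<longrightarrow>
        (\<exists>C::real. \<forall>\<phi>. arithmetic_fun_bounded a \<phi> \<longrightarrow>
          (\<forall>x::real. x \<ge> 1 \<longrightarrow>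
            norm ((\<Sum>n | 1 \<le> n \<and> real n \<le> x. \<phi> (num_distinct_exponents n))
                  - M_const A \<phi> * of_real x)
              \<le> C * x powr (1/2 + \<epsilon>)))))"
proof (intro exI[of _ level_density] conjI allI impI)
  show "level_density k > 0" if "k \<ge> 1" for k
    using that by (rule level_density_pos)
next
  fix a :: real assume a: "a > 1"
  have bound: "norm (\<phi> k) \<le> a ^ k" if "arithmetic_fun_bounded a \<phi>" for \<phi> k
    using that by (cases "k = 0") (auto simp: arithmetic_fun_bounded_def less_imp_le)
  have sums: "M_term level_density \<phi> sums mean_value \<phi>" if "arithmetic_fun_bounded a \<phi>" for \<phi>
    unfolding M_term_def[abs_def] using level_density_sums[of a \<phi>] a bound[OF that] by simp
  show "summable (M_term level_density \<phi>)" if "arithmetic_fun_bounded a \<phi>" for \<phi>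
    using sums[OF that] by (rule sums_summable)
  fix \<epsilon> :: real assume \<epsilon>: "\<epsilon> > 0"
  \<comment> \<open>For large \<open>\<epsilon>\<close> the exponent is capped at 1, the limit of validity of the floor estimate.\<close>
  define t where "t = 1/2 + min \<epsilon> (1/2)"
  have t: "1/2 < t" "t \<le> 1" "t \<le> 1/2 + \<epsilon>" using \<epsilon> by (auto simp: t_def)
  define C where "C = 3 * a * (\<Sum>n. powerful_weight (2 * a) n * real n powr - t)"
  have "C \<ge> 0"
    unfolding C_def using a t
    by (intro mult_nonneg_nonneg suminf_nonneg summable_powerful_weight)
      (auto simp: powerful_weight_nonneg)
  have "norm ((\<Sum>n | 1 \<le> n \<and> real n \<le> x. \<phi> (num_distinct_exponents n))
                  - M_const level_density \<phi> * of_real x) \<le> C * x powr (1/2 + \<epsilon>)"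
    if \<phi>: "arithmetic_fun_bounded a \<phi>" and x: "x \<ge> 1" for \<phi> x
  proof -
    have "M_const level_density \<phi> = mean_value \<phi>"
      unfolding M_const_def using sums[OF \<phi>] by (rule sums_unique[symmetric])
    then have "norm ((\<Sum>n | 1 \<le> n \<and> real n \<le> x. \<phi> (num_distinct_exponents n))
                  - M_const level_density \<phi> * of_real x) \<le> C * x powr t"
      unfolding C_def using a t x bound[OF \<phi>]
      by (simp only:) (rule sum_num_distinct_exponents_asymptotic, auto)
    also have "\<dots> \<le> C * x powr (1/2 + \<epsilon>)"
      using \<open>C \<ge> 0\<close> t x by (intro mult_left_mono powr_mono) auto
    finally show ?thesis .
  qed
  then show "\<exists>C. \<forall>\<phi>. arithmetic_fun_bounded a \<phi> \<longrightarrow>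
          (\<forall>x::real. x \<ge> 1 \<longrightarrow>
            norm ((\<Sum>n | 1 \<le> n \<and> real n \<le> x. \<phi> (num_distinct_exponents n))
                  - M_const level_density \<phi> * of_real x)
              \<le> C * x powr (1/2 + \<epsilon>))"
    by blast
qed

end
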